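(* There is an absolute constant $C>0$ such that the following holds. Let $\epsilon\ge 0$, $\delta\ge0$, $\delta'>0$, and let $\mathcal D$ be a family of pairs of probability distributions on $\mathbb{R}^d$ that is $(\epsilon,\delta)$-robustly feasible. Let $\mathcal F_{\mathcal D}=\{f_D: D\in\mathcal D\}$, where for each $D\in\mathcal D$, $f_D$ is an (arbitrarily chosen) $(\epsilon,\delta)$-robust classifier for $D$, and suppose $\mathcal F_{\mathcal D}$ is finite. Then $\mathcal D$ is $(\epsilon,\delta+\delta')$-robustly learnable with $n$ samples whenever $$n\ge C\,\frac{\delta+\delta'}{\delta'^2}\,\log(|\mathcal F_{\mathcal D}|).$$
   Context: Fix a norm $\|\cdot\|$ on $\mathbb{R}^d$ and let $B(\epsilon)=\{z\in\mathbb{R}^d:\|z\|\le\epsilon\}$. For $f:\mathbb{R}^d\to\{0,1\}$ and $(x,i)\in\mathbb{R}^d\times\{0,1\}$, the $\epsilon$-robust zero-one loss is $\ell_\epsilon(f,x,i)=\mathbf 1\{\exists z\in B(\epsilon): f(x+z)\ne i\}$. A classifier $f:\mathbb{R}^d\to\{0,1\}$ is $(\epsilon,\delta)$-robust for a pair of distributions $D=(D_0,D_1)$ if $\mathbb{E}_{X\sim D_i}[\ell_\epsilon(f,X,i)]\le\delta$ for each $i\in\{0,1\}$. A classification task is a family $\mathcal D$ of pairs $D=(D_0,D_1)$ of distributions on $\mathbb{R}^d$. A classification algorithm receives datasets $\underline X_0,\underline X_1$ consisting of $n$ i.i.d. samples from $D_0$ and $D_1$ respectively, and outputs a classifier $f:\mathbb{R}^d\to\{0,1\}$.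 $\mathcal D$ is $(\epsilon,\delta)$-robustly learnable with $n$ samples if there is a classification algorithm such that for every $D\in\mathcal D$, with probability at least $2/3$ over $\underline X_0,\underline X_1$, the algorithm outputs a classifier that is $(\epsilon,\delta)$-robust for $D$ (no computational restriction). $\mathcal D$ is $(\epsilon,\delta)$-robustly feasible if every $D\in\mathcal D$ admits an $(\epsilon,\delta)$-robust classifier. Measurability questions are ignored. *)

theory Defs
  imports "HOL-Probability.Probability"
begin

(* Dimension d is a number rather than a type, so that a constant can be chosen before d.
   In the library's Euclidean_space d a point is a sequence vanishing from index d on, so
   linear operations are pointwise. *)

abbreviation Rd :: "nat \<Rightarrow> (nat \<Rightarrow> real) set" where
  "Rd d \<equiv> topspace (Euclidean_space d)"

definition is_norm :: "nat \<Rightarrow> ((nat \<Rightarrow> real) \<Rightarrow> real) \<Rightarrow> bool" where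
  "is_norm d N \<longleftrightarrow>
     (\<forall>x\<in>Rd d. N x \<ge> 0 \<and> (N x = 0 \<longleftrightarrow> x = (\<lambda>k. 0))) \<and>
     (\<forall>x\<in>Rd d. \<forall>c. N (\<lambda>k. c * x k) = \<bar>c\<bar> * N x) \<and>
     (\<forall>x\<in>Rd d. \<forall>y\<in>Rd d. N (\<lambda>k. x k + y k) \<le> N x + N y)"

definition norm_ball :: "nat \<Rightarrow> ((nat \<Rightarrow> real) \<Rightarrow> real) \<Rightarrow> real \<Rightarrow> (nat \<Rightarrow> real) set" where
  "norm_ball d N \<epsilon> = {z \<in> Rd d. N z \<le> \<epsilon>}"

(* Extensional function space: classifiers are equal iff they agree on R^d, so that
   counting a set of classifiers does not count values outside R^d. *)
definition classifiers :: "nat \<Rightarrow> ((nat \<Rightarrow> real) \<Rightarrow> nat) set" where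
  "classifiers d = Rd d \<rightarrow>\<^sub>E {0, 1}"

definition robust_loss ::
  "nat \<Rightarrow> ((nat \<Rightarrow> real) \<Rightarrow> real) \<Rightarrow> real \<Rightarrow> ((nat \<Rightarrow> real) \<Rightarrow> nat) \<Rightarrow> (nat \<Rightarrow> real) \<Rightarrow> nat \<Rightarrow> real" where
  "robust_loss d N \<epsilon> f x i = (if \<exists>z\<in>norm_ball d N \<epsilon>. f (\<lambda>k. x k + z k) \<noteq> i then 1 else 0)"

(* The sigma-algebra contains the Borel sets but may be larger, for example their completion:
   the robust loss of a Borel classifier is in general only universally measurable. *)
definition distribution_on :: "nat \<Rightarrow> (nat \<Rightarrow> real) measure \<Rightarrow> bool" where
  "distribution_on d M \<longleftrightarrow>
     prob_space M \<and> space M = Rd d \<and> (\<forall>U. openin (Euclidean_space d) U \<longrightarrow> U \<in> sets M)"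

type_synonym dist_pair = "(nat \<Rightarrow> real) measure \<times> (nat \<Rightarrow> real) measure"

definition class_dist :: "dist_pair \<Rightarrow> nat \<Rightarrow> (nat \<Rightarrow> real) measure" where
  "class_dist D i = (if i = 0 then fst D else snd D)"

definition classification_task :: "nat \<Rightarrow> dist_pair set \<Rightarrow> bool" where
  "classification_task d \<D> \<longleftrightarrow> (\<forall>D\<in>\<D>. \<forall>i\<in>{0, 1}. distribution_on d (class_dist D i))"

(* Integrability is required because the integral of a non-measurable function is 0. *)
definition robust_classifier ::
  "nat \<Rightarrow> ((nat \<Rightarrow> real) \<Rightarrow> real) \<Rightarrow> real \<Rightarrow> real \<Rightarrow> dist_pair \<Rightarrow> ((nat \<Rightarrow> real) \<Rightarrow> nat) \<Rightarrow> bool" where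
  "robust_classifier d N \<epsilon> \<delta> D f \<longleftrightarrow>
     f \<in> classifiers d \<and>
     (\<forall>i\<in>{0, 1}. integrable (class_dist D i) (\<lambda>x. robust_loss d N \<epsilon> f x i) \<and>
        (LINT x|class_dist D i. robust_loss d N \<epsilon> f x i) \<le> \<delta>)"

definition robustly_feasible ::
  "nat \<Rightarrow> ((nat \<Rightarrow> real) \<Rightarrow> real) \<Rightarrow> real \<Rightarrow> real \<Rightarrow> dist_pair set \<Rightarrow> bool" where
  "robustly_feasible d N \<epsilon> \<delta> \<D> \<longleftrightarrow> (\<forall>D\<in>\<D>. \<exists>f. robust_classifier d N \<epsilon> \<delta> D f)"

definition sample_space ::
  "nat \<Rightarrow> dist_pair \<Rightarrow> ((nat \<Rightarrow> nat \<Rightarrow> real) \<times> (nat \<Rightarrow> nat \<Rightarrow> real)) measure" where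
  "sample_space n D =
     PiM {..<n} (\<lambda>_. class_dist D 0) \<Otimes>\<^sub>M PiM {..<n} (\<lambda>_. class_dist D 1)"

definition classification_algorithm ::
  "nat \<Rightarrow> nat \<Rightarrow> ((nat \<Rightarrow> nat \<Rightarrow> real) \<Rightarrow> (nat \<Rightarrow> nat \<Rightarrow> real) \<Rightarrow> ((nat \<Rightarrow> real) \<Rightarrow> nat)) \<Rightarrow> bool" where
  "classification_algorithm d n A \<longleftrightarrow>
     (\<forall>X0 \<in> {..<n} \<rightarrow>\<^sub>E Rd d. \<forall>X1 \<in> {..<n} \<rightarrow>\<^sub>E Rd d. A X0 X1 \<in> classifiers d)"

(* A non-measurable set has measure 0, so the bound 2/3 entails that the success event
   is measurable. *)
definition robustly_learnable ::
  "nat \<Rightarrow> ((nat \<Rightarrow> real) \<Rightarrow> real) \<Rightarrow> real \<Rightarrow> real \<Rightarrow> dist_pair set \<Rightarrow> nat \<Rightarrow> bool" where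
  "robustly_learnable d N \<epsilon> \<delta> \<D> n \<longleftrightarrow>
     (\<exists>A. classification_algorithm d n A \<and>
        (\<forall>D\<in>\<D>. measure (sample_space n D)
            {X \<in> space (sample_space n D). robust_classifier d N \<epsilon> \<delta> D (A (fst X) (snd X))}
          \<ge> 2 / 3))"

(* Standing measurability convention: every chosen classifier has measurable robust loss
   under every pair in the family, not only the pair for which it was chosen. *)
definition losses_measurable ::
  "nat \<Rightarrow> ((nat \<Rightarrow> real) \<Rightarrow> real) \<Rightarrow> real \<Rightarrow> dist_pair set \<Rightarrow> ((nat \<Rightarrow> real) \<Rightarrow> nat) set \<Rightarrow> bool" where
  "losses_measurable d N \<epsilon> \<D> F \<longleftrightarrow>
     (\<forall>D\<in>\<D>. \<forall>f\<in>F. \<forall>i\<in>{0, 1}.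
        (\<lambda>x. robust_loss d N \<epsilon> f x i) \<in> borel_measurable (class_dist D i))"

end

theory Submission
  imports Defs
begin

text \<open>The algorithm outputs any classifier of the finite family whose empirical robust loss is at most
  \<open>\<delta> + \<delta>' / 2\<close> for both classes. By Chernoff bounds with parameter \<open>s = \<delta>' / (4 (\<delta> + \<delta>'))\<close>,
  the classifier chosen for the true pair fails this test for a given class, and a classifier that is
  not \<open>(\<epsilon>, \<delta> + \<delta>')\<close>-robust passes it, each with probability at most
  \<open>exp (- n \<delta>'\<^sup>2 / (16 (\<delta> + \<delta>')))\<close>; a union bound then gives \<open>C = 64\<close>. The selection
  depends on the sample only through the set of passing classifiers, so the success event is a
  finite union of measurable sets. A family with a single classifier needs no samples.\<close>

section \<open>A Chernoff bound for sums of i.i.d. variables in [0, 1]\<close>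

lemma exp_le_quadratic:
  fixes x :: real
  assumes "\<bar>x\<bar> \<le> 1"
  shows "exp x \<le> 1 + x + x\<^sup>2"
proof (cases "x \<ge> 0")
  case True
  then show ?thesis using assms exp_bound[of x] by simp
next
  case False
  then have "1 - x > 0" by simp
  \<comment> \<open>For negative \<open>x\<close> the claim amounts to
    \<open>1 \<le> (1 + x + x\<^sup>2) * exp (- x)\<close>. Replacing \<open>exp (- x)\<close> by
    the smaller \<open>1 - x\<close> makes the product collapse to \<open>1 - x ^ 3\<close>.\<close>
  have "1 \<le> 1 - x ^ 3"
    using False by (simp add: power3_eq_cube mult_nonneg_nonpos)
  also have "\<dots> = (1 + x + x\<^sup>2) * (1 - x)"
    by (simp add: algebra_simps power2_eq_square power3_eq_cube)
  also have "\<dots> \<le> (1 + x + x\<^sup>2) * exp (- x)"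
  proof (rule mult_left_mono)
    show "1 - x \<le> exp (- x)" using exp_ge_add_one_self[of "- x"] by simp
    show "0 \<le> 1 + x + x\<^sup>2" using assms by (simp add: abs_le_iff)
  qed
  finally show ?thesis by (simp add: exp_minus field_simps)
qed

text \<open>On [0, 1] the square of \<open>L\<close> is at most \<open>L\<close>, so the quadratic
  term of \<open>exp_le_quadratic\<close> is absorbed into the mean. The exponent is then
  proportional to the mean, which is what leads to a rate of order
  \<open>(\<delta> + \<delta>') / \<delta>'\<^sup>2\<close> instead of
  \<open>1 / \<delta>'\<^sup>2\<close>.\<close>

lemma (in prob_space) expectation_exp_le:
  fixes L :: "'a \<Rightarrow> real"
  assumes L [measurable]: "L \<in> borel_measurable M"
    and bnd: "\<And>x. 0 \<le> L x" "\<And>x. L x \<le> 1"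
    and s: "\<bar>s\<bar> \<le> 1"
  shows "integrable M (\<lambda>x. exp (s * L x))"
    and "expectation (\<lambda>x. exp (s * L x)) \<le> exp (expectation L * (s + s\<^sup>2))"
proof -
  have sL: "\<bar>s * L x\<bar> \<le> 1" for x
    using bnd[of x] s by (simp add: abs_mult mult_le_one)
  show int: "integrable M (\<lambda>x. exp (s * L x))"
  proof (rule integrable_const_bound[where B = "exp 1"])
    show "AE x in M. norm (exp (s * L x)) \<le> exp 1"
      using sL by (auto simp: abs_le_iff)
  qed measurable
  have intL: "integrable M L"
    by (rule integrable_const_bound[where B = 1]) (use bnd in auto)
  have "expectation (\<lambda>x. exp (s * L x)) \<le> expectation (\<lambda>x. 1 + (s + s\<^sup>2) * L x)"
  proof (rule integral_mono[OF int])
    show "integrable M (\<lambda>x. 1 + (s + s\<^sup>2) * L x)" using intL by simp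
    fix x
    have "L x * L x \<le> L x * 1" using bnd[of x] by (intro mult_left_mono) auto
    then have "s\<^sup>2 * (L x)\<^sup>2 \<le> s\<^sup>2 * L x"
      by (intro mult_left_mono) (auto simp: power2_eq_square)
    then show "exp (s * L x) \<le> 1 + (s + s\<^sup>2) * L x"
      using exp_le_quadratic[OF sL[of x]] by (simp add: algebra_simps power_mult_distrib)
  qed
  also have "\<dots> = 1 + expectation L * (s + s\<^sup>2)" using intL by (simp add: prob_space)
  also have "\<dots> \<le> exp (expectation L * (s + s\<^sup>2))" by (rule exp_ge_add_one_self)
  finally show "expectation (\<lambda>x. exp (s * L x)) \<le> exp (expectation L * (s + s\<^sup>2))" .
qed

text \<open>Markov's inequality for the exponential of the sum, whose expectation factorises over
  the product measure. The sign of \<open>s\<close> is left free: positive \<open>s\<close> gives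
  the upper tail, negative \<open>s\<close> the lower tail.\<close>

lemma (in prob_space) chernoff_iid:
  fixes L :: "'a \<Rightarrow> real"
  assumes L [measurable]: "L \<in> borel_measurable M"
    and bnd: "\<And>x. 0 \<le> L x" "\<And>x. L x \<le> 1"
    and s: "\<bar>s\<bar> \<le> 1"
  shows "measure (PiM {..<n} (\<lambda>_. M)) {X \<in> space (PiM {..<n} (\<lambda>_. M)). c \<le> s * (\<Sum>j<n. L (X j))}
           \<le> exp (real n * expectation L * (s + s\<^sup>2) - c)"
proof -
  let ?P = "PiM {..<n} (\<lambda>_. M)"
  interpret PS: product_prob_space "\<lambda>_::nat. M" UNIV
    by unfold_locales
  interpret P: prob_space ?P
    by (intro prob_space_PiM) unfold_locales
  let ?G = "\<lambda>X. \<Prod>j<n. exp (s * L (X j))"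
  have G: "?G X = exp (s * (\<Sum>j<n. L (X j)))" for X
    by (simp add: exp_sum sum_distrib_left)
  have intG: "integrable ?P ?G"
    by (intro PS.product_integrable_prod expectation_exp_le assms) auto
  have "measure ?P {X \<in> space ?P. c \<le> s * (\<Sum>j<n. L (X j))}
          = measure ?P {X \<in> space ?P. exp c \<le> ?G X}"
    by (simp only: G exp_le_cancel_iff)
  also have "\<dots> \<le> (LINT X|?P. ?G X) / exp c"
    by (intro integral_Markov_inequality_measure[where A = "{}"] intG AE_I2 prod_nonneg) auto
  also have "(LINT X|?P. ?G X) = expectation (\<lambda>x. exp (s * L x)) ^ n"
    by (subst PS.product_integral_prod) (auto intro!: expectation_exp_le assms)
  also have "\<dots> \<le> exp (expectation L * (s + s\<^sup>2)) ^ n"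
    by (intro power_mono expectation_exp_le assms) (auto intro: integral_nonneg)
  also have "\<dots> = exp (real n * expectation L * (s + s\<^sup>2))"
    by (simp add: exp_of_nat_mult[symmetric] mult.assoc)
  finally show ?thesis by (simp add: exp_diff divide_right_mono)
qed

section \<open>Selecting a candidate that passes every test\<close>

text \<open>If \<open>g\<close> passes, the selection is made from a nonempty set, and it lies in
  \<open>G\<close> unless some candidate outside \<open>G\<close> passes. The union bound therefore
  runs over \<open>card I\<close> ways for \<open>g\<close> to fail and at most
  \<open>card F\<close> bad candidates.\<close>

lemma (in prob_space) prob_select_passing_ge:
  fixes S :: "'f \<Rightarrow> 'i \<Rightarrow> 'a \<Rightarrow> real" and r t :: real
  assumes "finite F" "finite I"
    and meas: "\<And>f i. f \<in> F \<Longrightarrow> i \<in> I \<Longrightarrow> S f i \<in> borel_measurable M"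
    and sel: "\<And>P. P \<subseteq> F \<Longrightarrow> P \<noteq> {} \<Longrightarrow> sel P \<in> P"
    and g: "g \<in> F"
    and upper: "\<And>i. i \<in> I \<Longrightarrow> prob {x \<in> space M. t < S g i x} \<le> r"
    and lower: "\<And>f. f \<in> F \<Longrightarrow> f \<notin> G \<Longrightarrow> \<exists>i\<in>I. prob {x \<in> space M. S f i x \<le> t} \<le> r"
    and "0 \<le> r"
  shows "prob {x \<in> space M. sel {f \<in> F. \<forall>i\<in>I. S f i x \<le> t} \<in> G} \<ge> 1 - real (card I + card F) * r"
proof -
  define pass where "pass x = {f \<in> F. \<forall>i\<in>I. S f i x \<le> t}" for x
  define E where "E = {x \<in> space M. sel (pass x) \<in> G}"
  have le_sets: "{x \<in> space M. S f i x \<le> t} \<in> events" if "f \<in> F" "i \<in> I" for f i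
    using meas[OF that] by measurable
  have gt_sets: "{x \<in> space M. t < S f i x} \<in> events" if "f \<in> F" "i \<in> I" for f i
    using meas[OF that] by measurable
  have pass_eq: "{x \<in> space M. pass x = P} \<in> events" if "P \<subseteq> F" for P
  proof -
    have "{x \<in> space M. pass x = P} =
        {x \<in> space M. \<forall>f\<in>F. (\<forall>i\<in>I. S f i x \<le> t) = (f \<in> P)}"
      using that by (auto simp: pass_def)
    also have "\<dots> \<in> events"
      using \<open>finite F\<close> \<open>finite I\<close> le_sets by (intro sets.sets_Collect sets.sets_Collect_finite_All) auto
    finally show ?thesis .
  qed
  have "E = (\<Union>P\<in>{P \<in> Pow F. sel P \<in> G}. {x \<in> space M. pass x = P})"
    by (auto simp: E_def pass_def)
  also have "\<dots> \<in> events" using \<open>finite F\<close> pass_eq by (intro sets.finite_UN) auto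
  finally have E: "E \<in> events" .
  \<comment> \<open>One index per bad candidate is enough, because passing means passing at every
    index. Hence the sum \<open>card I + card F\<close> and not a product.\<close>
  from lower obtain k where k: "\<And>f. f \<in> F - G \<Longrightarrow> k f \<in> I"
      "\<And>f. f \<in> F - G \<Longrightarrow> prob {x \<in> space M. S f (k f) x \<le> t} \<le> r"
    by (metis DiffE)
  let ?U = "\<Union>i\<in>I. {x \<in> space M. t < S g i x}"
  let ?L = "\<Union>f\<in>F - G. {x \<in> space M. S f (k f) x \<le> t}"
  have U: "?U \<in> events" using gt_sets[OF g] \<open>finite I\<close> by (intro sets.finite_UN) auto
  have L: "?L \<in> events" using le_sets k \<open>finite F\<close> by (intro sets.finite_UN) auto
  have "space M - E \<subseteq> ?U \<union> ?L"
  proof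
    fix x assume x: "x \<in> space M - E"
    show "x \<in> ?U \<union> ?L"
    proof (cases "g \<in> pass x")
      case True
      then have "sel (pass x) \<in> pass x" by (intro sel) (auto simp: pass_def)
      moreover have "sel (pass x) \<notin> G" using x by (auto simp: E_def)
      ultimately have "sel (pass x) \<in> F - G" "\<forall>i\<in>I. S (sel (pass x)) i x \<le> t"
        by (auto simp: pass_def)
      then show ?thesis using k x by blast
    next
      case False
      then show ?thesis using g x by (force simp: pass_def not_le)
    qed
  qed
  then have "prob (space M - E) \<le> prob (?U \<union> ?L)" using U L by (intro finite_measure_mono) auto
  also have "\<dots> \<le> prob ?U + prob ?L" by (rule measure_Un_le[OF U L])
  also have "prob ?U \<le> (\<Sum>i\<in>I. prob {x \<in> space M. t < S g i x})"
    using gt_sets[OF g] \<open>finite I\<close> by (intro measure_UNION_le) auto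
  also have "\<dots> \<le> card I * r" using upper by (rule sum_bounded_above)
  also have "prob ?L \<le> (\<Sum>f\<in>F - G. prob {x \<in> space M. S f (k f) x \<le> t})"
    using le_sets k \<open>finite F\<close> by (intro measure_UNION_le) auto
  also have "\<dots> \<le> card (F - G) * r" using k(2) by (rule sum_bounded_above)
  also have "\<dots> \<le> card F * r"
    using \<open>0 \<le> r\<close> \<open>finite F\<close> by (intro mult_right_mono) (auto intro: card_mono)
  finally have "prob (space M - E) \<le> real (card I + card F) * r" by (simp add: algebra_simps)
  then show ?thesis using prob_compl[OF E] by (simp add: E_def pass_def)
qed

section \<open>The empirical robust loss of one class under the joint sample\<close>

text \<open>Access by label, parallel to \<open>class_dist\<close>, lets both classes be treated by
  the same statements.\<close>

definition class_sample ::
  "nat \<Rightarrow> (nat \<Rightarrow> nat \<Rightarrow> real) \<times> (nat \<Rightarrow> nat \<Rightarrow> real) \<Rightarrow> (nat \<Rightarrow> nat \<Rightarrow> real)" where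
  "class_sample i X = (if i = 0 then fst X else snd X)"

text \<open>Kept as a sum and not an average, so that \<open>n = 0\<close> causes no division; the
  test threshold carries the factor \<open>n\<close> instead.\<close>

definition total_loss ::
  "nat \<Rightarrow> ((nat \<Rightarrow> real) \<Rightarrow> real) \<Rightarrow> real \<Rightarrow> nat \<Rightarrow> ((nat \<Rightarrow> real) \<Rightarrow> nat) \<Rightarrow> nat
     \<Rightarrow> (nat \<Rightarrow> nat \<Rightarrow> real) \<times> (nat \<Rightarrow> nat \<Rightarrow> real) \<Rightarrow> real" where
  "total_loss d N \<epsilon> n f i X = (\<Sum>j<n. robust_loss d N \<epsilon> f (class_sample i X j) i)"

lemma prob_space_sample_space:
  assumes "prob_space (class_dist D 0)" "prob_space (class_dist D 1)"
  shows "prob_space (sample_space n D)"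
  unfolding sample_space_def by (intro prob_space_pair prob_space_PiM assms)

lemma measurable_class_sample:
  assumes "i \<in> {0, 1}"
  shows "class_sample i \<in> sample_space n D \<rightarrow>\<^sub>M PiM {..<n} (\<lambda>_. class_dist D i)"
  using assms unfolding class_sample_def[abs_def] sample_space_def by auto

lemma (in prob_space) distr_pair_snd:
  assumes "sigma_finite_measure N"
  shows "distr (M \<Otimes>\<^sub>M N) N snd = N"
proof (intro measure_eqI)
  interpret N: sigma_finite_measure N by fact
  fix A assume A: "A \<in> sets (distr (M \<Otimes>\<^sub>M N) N snd)"
  then have "emeasure (distr (M \<Otimes>\<^sub>M N) N snd) A = emeasure (M \<Otimes>\<^sub>M N) (space M \<times> A)"
    by (auto simp add: emeasure_distr space_pair_measure dest: sets.sets_into_space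
          intro!: arg_cong2[where f=emeasure])
  with A show "emeasure (distr (M \<Otimes>\<^sub>M N) N snd) A = emeasure N A"
    by (simp add: N.emeasure_pair_measure_Times emeasure_space_1)
qed simp

lemma distr_class_sample:
  assumes P: "prob_space (class_dist D 0)" "prob_space (class_dist D 1)" and "i \<in> {0, 1}"
  shows "distr (sample_space n D) (PiM {..<n} (\<lambda>_. class_dist D i)) (class_sample i)
           = PiM {..<n} (\<lambda>_. class_dist D i)"
proof -
  interpret P0: prob_space "PiM {..<n} (\<lambda>_. class_dist D 0)" by (intro prob_space_PiM P)
  interpret P1: prob_space "PiM {..<n} (\<lambda>_. class_dist D 1)" by (intro prob_space_PiM P)
  have "class_sample 0 = fst" "class_sample 1 = snd" by (auto simp: class_sample_def)
  then show ?thesis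
    using \<open>i \<in> {0, 1}\<close> P1.distr_pair_fst P0.distr_pair_snd[OF P1.sigma_finite_measure_axioms]
    by (auto simp: sample_space_def)
qed

lemma measurable_total_loss:
  assumes "i \<in> {0, 1}" and "(\<lambda>x. robust_loss d N \<epsilon> f x i) \<in> borel_measurable (class_dist D i)"
  shows "total_loss d N \<epsilon> n f i \<in> borel_measurable (sample_space n D)"
proof -
  have [measurable]: "class_sample i \<in> sample_space n D \<rightarrow>\<^sub>M PiM {..<n} (\<lambda>_. class_dist D i)"
    by (rule measurable_class_sample) fact
  note assms(2)[measurable]
  show ?thesis unfolding total_loss_def[abs_def] by measurable
qed

text \<open>The event involves the sample of one class only, so its probability can be computed
  under that marginal, an n-fold product to which \<open>chernoff_iid\<close> applies.\<close>

lemma total_loss_tail: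
  assumes P: "prob_space (class_dist D 0)" "prob_space (class_dist D 1)" and i: "i \<in> {0, 1}"
    and meas: "(\<lambda>x. robust_loss d N \<epsilon> f x i) \<in> borel_measurable (class_dist D i)"
    and s: "\<bar>s\<bar> \<le> 1"
  shows "measure (sample_space n D) {X \<in> space (sample_space n D). c \<le> s * total_loss d N \<epsilon> n f i X}
    \<le> exp (real n * (LINT x|class_dist D i. robust_loss d N \<epsilon> f x i) * (s + s\<^sup>2) - c)"
proof -
  let ?Q = "PiM {..<n} (\<lambda>_. class_dist D i)"
  let ?T = "{Y \<in> space ?Q. c \<le> s * (\<Sum>j<n. robust_loss d N \<epsilon> f (Y j) i)}"
  interpret prob_space "class_dist D i" using P i by auto
  note meas[measurable]
  have "?T \<in> sets ?Q" by measurable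
  then have "measure ?Q ?T = measure (sample_space n D) (class_sample i -` ?T \<inter> space (sample_space n D))"
    by (subst (1) distr_class_sample[OF P i, symmetric])
       (simp add: measure_distr measurable_class_sample[OF i])
  also have "class_sample i -` ?T \<inter> space (sample_space n D)
      = {X \<in> space (sample_space n D). c \<le> s * total_loss d N \<epsilon> n f i X}"
    using measurable_space[OF measurable_class_sample[OF i, of n D]] by (auto simp: total_loss_def)
  finally show ?thesis
    using chernoff_iid[OF meas _ _ s, where n = n and c = c] by (simp add: robust_loss_def)
qed

section \<open>Constants and the learning guarantee\<close>

text \<open>The failure events number at most \<open>2 + k\<close>: two classes and \<open>k\<close>
  classifiers. The factor 4 is the least integer that works at \<open>k = 2\<close>, where
  \<open>3 * (2 + k) = 12\<close> lies between \<open>2 ^ 3\<close> and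
  \<open>2 ^ 4\<close>.\<close>

lemma union_bound_arith:
  fixes a r :: real
  assumes "k \<ge> 2" and "a \<ge> 4 * ln (real k)"
  shows "real (2 + k) * exp (- a) \<le> 1 / 3"
proof -
  have "exp (- a) \<le> exp (- (4 * ln (real k)))" using assms by simp
  also have "\<dots> = 1 / real k ^ 4"
    using assms by (simp add: exp_minus exp_of_nat_mult[where n = 4, simplified] inverse_eq_divide)
  finally have "real (2 + k) * exp (- a) \<le> real (2 + k) / real k ^ 4"
    using mult_left_mono[of _ _ "real (2 + k)"] by fastforce
  also have "\<dots> \<le> 1 / 3"
  proof -
    have "3 * real (2 + k) \<le> 2 ^ 3 * real k" using assms by simp
    also have "\<dots> \<le> real k ^ 3 * real k" using assms by (intro mult_right_mono power_mono) auto
    also have "\<dots> = real k ^ 4" by (simp add: power3_eq_cube power4_eq_xxxx)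
    finally have "3 * real (2 + k) \<le> real k ^ 4" .
    then show ?thesis using assms by (simp add: field_simps)
  qed
  finally show ?thesis .
qed

theorem theorem3p1:
  shows "\<exists>C::real. C > 0 \<and>
    (\<forall>(d::nat) (N :: (nat \<Rightarrow> real) \<Rightarrow> real) (\<epsilon>::real) (\<delta>::real) (\<delta>'::real) (\<D> :: dist_pair set)
       (fD :: dist_pair \<Rightarrow> (nat \<Rightarrow> real) \<Rightarrow> nat) (n::nat).
       is_norm d N \<longrightarrow> \<epsilon> \<ge> 0 \<longrightarrow> \<delta> \<ge> 0 \<longrightarrow> \<delta>' > 0 \<longrightarrow>
       classification_task d \<D> \<longrightarrow>
       robustly_feasible d N \<epsilon> \<delta> \<D> \<longrightarrow>
       (\<forall>D\<in>\<D>. robust_classifier d N \<epsilon> \<delta> D (fD D)) \<longrightarrow>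
       losses_measurable d N \<epsilon> \<D> (fD ` \<D>) \<longrightarrow>
       finite (fD ` \<D>) \<longrightarrow>
       real n \<ge> C * ((\<delta> + \<delta>') / \<delta>'\<^sup>2) * ln (real (card (fD ` \<D>))) \<longrightarrow>
       robustly_learnable d N \<epsilon> (\<delta> + \<delta>') \<D> n)"
\<comment> \<open>\<open>64 = 16 * 4\<close>: 16 is the denominator in the Chernoff exponent and 4
  the factor of the logarithm in \<open>union_bound_arith\<close>.\<close>
proof (intro exI[of _ 64] conjI allI impI)
  fix d :: nat and N :: "(nat \<Rightarrow> real) \<Rightarrow> real" and \<epsilon> \<delta> \<delta>' :: real
    and \<D> :: "dist_pair set" and fD :: "dist_pair \<Rightarrow> (nat \<Rightarrow> real) \<Rightarrow> nat" and n :: nat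
  assume "\<delta> \<ge> 0" "\<delta>' > 0" and task: "classification_task d \<D>"
    and fD: "\<forall>D\<in>\<D>. robust_classifier d N \<epsilon> \<delta> D (fD D)"
    and lm: "losses_measurable d N \<epsilon> \<D> (fD ` \<D>)"
    and fin: "finite (fD ` \<D>)"
    and n: "real n \<ge> 64 * ((\<delta> + \<delta>') / \<delta>'\<^sup>2) * ln (real (card (fD ` \<D>)))"
  define F where "F = fD ` \<D>"
  define \<Delta> where "\<Delta> = \<delta> + \<delta>'"
  \<comment> \<open>The threshold is \<open>n\<close> times the midpoint of \<open>\<delta>\<close>
    and \<open>\<delta> + \<delta>'\<close>, leaving a margin of \<open>\<delta>' / 2\<close> per
    sample on either side.\<close>
  define t where "t = real n * (\<delta> + \<delta>' / 2)"
  \<comment> \<open>This \<open>s\<close> minimises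
    \<open>\<Delta> * s\<^sup>2 - s * \<delta>' / 2\<close>, the exponent per sample in both tails;
    the minimum \<open>- s * \<delta>' / 4\<close> gives \<open>r\<close>.\<close>
  define s where "s = \<delta>' / (4 * \<Delta>)"
  define r where "r = exp (- (real n * s * \<delta>' / 4))"
  \<comment> \<open>The default for samples on which nothing passes. It is taken from
    \<open>F\<close> when possible, so that a one-element family always yields its only
    classifier.\<close>
  obtain f0 where f0: "f0 \<in> classifiers d" "F \<noteq> {} \<longrightarrow> f0 \<in> F"
  proof (cases "F = {}")
    case True
    have "(\<lambda>x\<in>Rd d. 0) \<in> classifiers d" by (auto simp: classifiers_def)
    with True that show ?thesis by blast
  next
    case False
    then obtain D where "D \<in> \<D>" by (auto simp: F_def)
    with fD that[of "fD D"] show ?thesis by (auto simp: F_def robust_classifier_def)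
  qed
  define sel where "sel P = (if P = {} then f0 else SOME f. f \<in> P)" for P
  have sel: "sel P \<in> P" if "P \<noteq> {}" for P
    using that by (simp add: sel_def some_in_eq)
  define A where "A X0 X1 = sel {f \<in> F. \<forall>i\<in>{0, 1}. total_loss d N \<epsilon> n f i (X0, X1) \<le> t}" for X0 X1
  have F_classifiers: "F \<subseteq> classifiers d" using fD by (auto simp: F_def robust_classifier_def)
  have A_F: "A X0 X1 = f0 \<or> A X0 X1 \<in> F" for X0 X1
  proof -
    let ?P = "{f \<in> F. \<forall>i\<in>{0, 1}. total_loss d N \<epsilon> n f i (X0, X1) \<le> t}"
    have "sel ?P = f0 \<or> sel ?P \<in> ?P" using sel[of ?P] by (cases "?P = {}") (auto simp: sel_def)
    then show ?thesis unfolding A_def by blast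
  qed
  have \<Delta>: "\<Delta> > 0" using \<open>\<delta> \<ge> 0\<close> \<open>\<delta>' > 0\<close> by (simp add: \<Delta>_def)
  have s\<Delta>: "\<Delta> * s = \<delta>' / 4" using \<Delta> by (simp add: s_def)
  have s: "0 < s" "s \<le> 1"
    using \<Delta> \<open>\<delta> \<ge> 0\<close> \<open>\<delta>' > 0\<close> by (auto simp: s_def \<Delta>_def)
  have s2: "\<Delta> * s\<^sup>2 = s * \<delta>' / 4"
    using s\<Delta> by (simp add: power2_eq_square mult.assoc[symmetric])
  have s3: "s - s\<^sup>2 \<ge> 0"
    using s by (simp add: power2_eq_square mult_left_le)
  have "measure (sample_space n D)
          {X \<in> space (sample_space n D). robust_classifier d N \<epsilon> \<Delta> D (A (fst X) (snd X))} \<ge> 2 / 3"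
    if D: "D \<in> \<D>" for D
  proof -
    have P: "prob_space (class_dist D 0)" "prob_space (class_dist D 1)"
      using task D by (auto simp: classification_task_def distribution_on_def)
    interpret prob_space "sample_space n D" by (rule prob_space_sample_space[OF P])
    have meas: "(\<lambda>x. robust_loss d N \<epsilon> f x i) \<in> borel_measurable (class_dist D i)"
      if "f \<in> F" "i \<in> {0, 1}" for f i
      using lm D that by (auto simp: losses_measurable_def F_def)
    \<comment> \<open>With integrability secured on \<open>F\<close>, a member of \<open>F\<close>
      outside \<open>G\<close> must have expected loss above \<open>\<Delta>\<close> for some
      class.\<close>
    have int: "integrable (class_dist D i) (\<lambda>x. robust_loss d N \<epsilon> f x i)"
      if "f \<in> F" "i \<in> {0, 1}" for f i
    proof -
      interpret D: prob_space "class_dist D i" using P that by auto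
      show ?thesis
        by (rule D.integrable_const_bound[where B = 1])
           (auto simp: robust_loss_def intro!: meas[OF that, unfolded robust_loss_def])
    qed
    have opt: "fD D \<in> F" "robust_classifier d N \<epsilon> \<delta> D (fD D)" using D fD by (auto simp: F_def)
    then have good: "robust_classifier d N \<epsilon> \<Delta> D (fD D)"
      using \<open>\<delta>' > 0\<close> by (auto simp: robust_classifier_def \<Delta>_def)
    define G where "G = {f. robust_classifier d N \<epsilon> \<Delta> D f}"
    have "F \<noteq> {}" using opt by auto
    show ?thesis
    proof (cases "card F \<ge> 2")
      \<comment> \<open>Here the logarithm vanishes and the hypothesis on \<open>n\<close> says
        nothing; the output is the only classifier whether or not it passes.\<close>
      case False
      moreover have "card F > 0" using fin \<open>F \<noteq> {}\<close> by (simp add: F_def card_gt_0_iff)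
      ultimately have "card F = 1" by simp
      then have "F = {fD D}" using opt by (metis card_1_singletonE singletonD)
      then have "A X0 X1 = fD D" for X0 X1 using A_F[of X0 X1] f0 by auto
      then show ?thesis using good by (simp add: prob_space)
    next
      case True
      have upper: "prob {X \<in> space (sample_space n D). t < total_loss d N \<epsilon> n (fD D) i X} \<le> r"
        if i: "i \<in> {0, 1}" for i
      proof -
        let ?\<mu> = "LINT x|class_dist D i. robust_loss d N \<epsilon> (fD D) x i"
        \<comment> \<open>The strict event is enlarged to the scaled non-strict one of
          \<open>total_loss_tail\<close>; monotonicity needs the larger event to be
          measurable.\<close>
        have "{X \<in> space (sample_space n D). s * t \<le> s * total_loss d N \<epsilon> n (fD D) i X} \<in> events"
          using measurable_total_loss[OF i meas[OF opt(1) i]] by measurable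
        then have "prob {X \<in> space (sample_space n D). t < total_loss d N \<epsilon> n (fD D) i X}
            \<le> prob {X \<in> space (sample_space n D). s * t \<le> s * total_loss d N \<epsilon> n (fD D) i X}"
          using s(1) by (intro finite_measure_mono) auto
        also have "\<dots> \<le> exp (real n * ?\<mu> * (s + s\<^sup>2) - s * t)"
          by (rule total_loss_tail) (use P i s meas opt in auto)
        also have "\<dots> \<le> r"
        proof -
          \<comment> \<open>With mean at most \<open>\<delta>\<close>, the linear terms leave
            \<open>- s * \<delta>' / 2\<close>, and \<open>\<delta> * s\<^sup>2\<close> is at most
            \<open>\<Delta> * s\<^sup>2 = s * \<delta>' / 4\<close>.\<close>
          have "?\<mu> * (s + s\<^sup>2) \<le> \<delta> * (s + s\<^sup>2)"
            using opt(2) i s by (intro mult_right_mono) (auto simp: robust_classifier_def)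
          moreover have "\<delta> * s\<^sup>2 \<le> \<Delta> * s\<^sup>2" using \<open>\<delta>' > 0\<close> by (intro mult_right_mono) (auto simp: \<Delta>_def)
          ultimately have "?\<mu> * (s + s\<^sup>2) - s * (\<delta> + \<delta>' / 2) \<le> - (s * \<delta>' / 4)"
            using s2 by (simp add: algebra_simps)
          from mult_left_mono[OF this, of "real n"]
          show ?thesis by (simp add: r_def t_def algebra_simps)
        qed
        finally show ?thesis .
      qed
      have lower: "\<exists>i\<in>{0, 1}. prob {X \<in> space (sample_space n D). total_loss d N \<epsilon> n f i X \<le> t} \<le> r"
        if f: "f \<in> F" "f \<notin> G" for f
      proof -
        have "f \<in> classifiers d" using f F_classifiers by blast
        moreover have "\<forall>i\<in>{0, 1}. integrable (class_dist D i) (\<lambda>x. robust_loss d N \<epsilon> f x i)"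
          using int[OF f(1)] by blast
        ultimately obtain i where i: "i \<in> {0, 1}"
          and big: "\<Delta> < (LINT x|class_dist D i. robust_loss d N \<epsilon> f x i)" (is "_ < ?\<mu>")
          using f(2) unfolding G_def robust_classifier_def mem_Collect_eq by (meson not_le)
        have "{X \<in> space (sample_space n D). total_loss d N \<epsilon> n f i X \<le> t}
            = {X \<in> space (sample_space n D). - s * t \<le> - s * total_loss d N \<epsilon> n f i X}"
          using s(1) by auto
        then have "prob {X \<in> space (sample_space n D). total_loss d N \<epsilon> n f i X \<le> t}
            = prob {X \<in> space (sample_space n D). - s * t \<le> - s * total_loss d N \<epsilon> n f i X}"
          by simp
        also have "\<dots> \<le> exp (real n * ?\<mu> * (- s + (- s)\<^sup>2) - (- s * t))"
          by (rule total_loss_tail) (use P i s meas f in auto)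
        also have "\<dots> \<le> r"
        proof -
          \<comment> \<open>The mean enters the lower tail with coefficient
            \<open>- (s - s\<^sup>2)\<close>, which is not positive, so the worst case is mean
            \<open>\<Delta>\<close>. There the exponent is again
            \<open>\<Delta> * s\<^sup>2 - s * \<delta>' / 2\<close>.\<close>
          have "\<Delta> * (s - s\<^sup>2) \<le> ?\<mu> * (s - s\<^sup>2)"
            using big s3 by (intro mult_right_mono) auto
          then have "?\<mu> * (- s + s\<^sup>2) + s * (\<delta> + \<delta>' / 2) \<le> - (s * \<delta>' / 4)"
            using s2 by (simp add: algebra_simps \<Delta>_def)
          from mult_left_mono[OF this, of "real n"]
          show ?thesis by (simp add: r_def t_def algebra_simps)
        qed
        finally show ?thesis using i by blast
      qed
      have "1 - real (card {0, 1::nat} + card F) * r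
          \<le> prob {X \<in> space (sample_space n D).
              sel {f \<in> F. \<forall>i\<in>{0, 1}. total_loss d N \<epsilon> n f i X \<le> t} \<in> G}"
      proof (rule prob_select_passing_ge[where g = "fD D"])
        show "total_loss d N \<epsilon> n f i \<in> borel_measurable (sample_space n D)"
          if "f \<in> F" "i \<in> {0, 1}" for f i
          using measurable_total_loss[OF that(2) meas[OF that]] .
        show "finite F" using fin by (simp add: F_def)
        show "0 \<le> r" by (simp add: r_def)
      qed (simp, (rule sel opt(1) upper lower; assumption)+)
      moreover have "real (2 + card F) * r \<le> 1 / 3"
        unfolding r_def
      proof (rule union_bound_arith[OF True])
        have "real n * s * \<delta>' / 4 = real n * (\<delta>'\<^sup>2 / (16 * \<Delta>))"
          by (simp add: s_def power2_eq_square)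
        also have "\<dots> \<ge> (64 * (\<Delta> / \<delta>'\<^sup>2) * ln (real (card F))) * (\<delta>'\<^sup>2 / (16 * \<Delta>))"
          using n \<Delta> by (intro mult_right_mono) (auto simp: F_def \<Delta>_def)
        also have "(64 * (\<Delta> / \<delta>'\<^sup>2) * ln (real (card F))) * (\<delta>'\<^sup>2 / (16 * \<Delta>)) = 4 * ln (real (card F))"
          using \<Delta> \<open>\<delta>' > 0\<close> by (simp add: field_simps)
        finally show "4 * ln (real (card F)) \<le> real n * s * \<delta>' / 4" .
      qed
      ultimately show ?thesis by (simp add: A_def G_def)
    qed
  qed
  moreover have "classification_algorithm d n A"
    using A_F f0 F_classifiers by (force simp: classification_algorithm_def)
  ultimately show "robustly_learnable d N \<epsilon> (\<delta> + \<delta>') \<D> n"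
    unfolding robustly_learnable_def \<Delta>_def by blast
qed simp

end
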